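(* Let $f(\varphi)=-\cos\varphi$ on $\mathbb{S}^1=\mathbb{R}/2\pi\mathbb{Z}$ and let $\tilde I>0$ be such that $c(\tilde I)=f(\pi)=1$. Then for any smooth test function $u\in C^\infty(\mathbb{S}^1;\mathbb{R})$, $$\lim_{k\to+\infty}\int_0^{2\pi}u(\varphi)\,\sigma_k(\tilde I,\varphi)\,d\varphi=u(\pi).$$
   Context: $k\ge1$ is an integer. $W:[0,+\infty)\to[0,+\infty)$ is the (real, increasing) Lambert function, $z=W(z)e^{W(z)}$. For $c\in\mathbb{R}$, $\varphi\in\mathbb{S}^1$: $\gamma_k(c,\varphi):=\sqrt{\frac{W(e^{2(c-f(\varphi))k}k)}{k}}$; $\gamma_0(c,\varphi):=\sqrt{2(c-f(\varphi))}$ if $c>f(\varphi)$ and $0$ otherwise. For $\tilde I>0$, $c_k(\tilde I)$ is the unique real $c$ with $\tilde I=\frac1{2\pi}\int_0^{2\pi}\gamma_k(c,\varphi)d\varphi$, and $c(\tilde I)$ is the unique real $c$ with $\tilde I=\frac1{2\pi}\int_0^{2\pi}\gamma_0(c,\varphi)d\varphi$. Finally $$\sigma_k(\tilde I,\varphi):=\frac{1/\gamma_k(c_k(\tilde I),\varphi)}{\int_0^{2\pi}\frac{dx}{\gamma_k(c_k(\tilde I),x)}}.$$ *)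

theory Defs
  imports "HOL-Analysis.Analysis"
begin

text \<open>
  The circle is \<open>\<real>/2\<pi>\<int>\<close>: a function on it is a \<open>2\<pi>\<close>-periodic function on the reals.
\<close>

definition smooth_on_circle :: "(real \<Rightarrow> real) \<Rightarrow> bool" where
  "smooth_on_circle u \<longleftrightarrow>
     (\<forall>\<phi>. u (\<phi> + 2 * pi) = u \<phi>) \<and> (\<forall>n \<phi>. (deriv ^^ n) u differentiable (at \<phi>))"

text \<open>Meaningful for \<open>z \<ge> 0\<close> only, where \<open>w\<close> exists and is unique.\<close>

definition Lambert_W :: "real \<Rightarrow> real" where
  "Lambert_W z = (THE w. 0 \<le> w \<and> z = w * exp w)"

text \<open>
  \<open>gamma_k\<close> and the notions built on it are intended for \<open>k \<ge> 1\<close>. The limiting profile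
  \<open>\<gamma>\<^sub>0\<close> is the separate function \<open>gamma_zero\<close>, not \<open>gamma_k f 0\<close>.
\<close>

definition gamma_k :: "(real \<Rightarrow> real) \<Rightarrow> nat \<Rightarrow> real \<Rightarrow> real \<Rightarrow> real" where
  "gamma_k f k c \<phi> = sqrt (Lambert_W (exp (2 * (c - f \<phi>) * real k) * real k) / real k)"

definition gamma_zero :: "(real \<Rightarrow> real) \<Rightarrow> real \<Rightarrow> real \<Rightarrow> real" where
  "gamma_zero f c \<phi> = (if c > f \<phi> then sqrt (2 * (c - f \<phi>)) else 0)"

definition c_k :: "(real \<Rightarrow> real) \<Rightarrow> nat \<Rightarrow> real \<Rightarrow> real" where
  "c_k f k I = (THE c. I = 1 / (2 * pi) * integral {0..2 * pi} (\<lambda>\<phi>. gamma_k f k c \<phi>))"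

definition c_zero :: "(real \<Rightarrow> real) \<Rightarrow> real \<Rightarrow> real" where
  "c_zero f I = (THE c. I = 1 / (2 * pi) * integral {0..2 * pi} (\<lambda>\<phi>. gamma_zero f c \<phi>))"

definition sigma_k :: "(real \<Rightarrow> real) \<Rightarrow> nat \<Rightarrow> real \<Rightarrow> real \<Rightarrow> real" where
  "sigma_k f k I \<phi> =
     (1 / gamma_k f k (c_k f k I) \<phi>) / integral {0..2 * pi} (\<lambda>x. 1 / gamma_k f k (c_k f k I) x)"

end

theory Submission
  imports Defs "HOL-Real_Asymp.Real_Asymp"
begin

text \<open>
  The number \<open>y = \<gamma>\<^sub>k\<^sup>2 > 0\<close> solves \<open>y + ln y / k = s\<close> with \<open>s = 2 (c - f \<phi>)\<close>. Hence \<open>y\<close> is strictly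
  increasing and 1-Lipschitz in \<open>s\<close>, and it differs from \<open>max s 0\<close> by \<open>O(ln k / k)\<close>, locally uniformly in \<open>s\<close>.
  So the averages of \<open>\<gamma>\<^sub>k\<close> converge to those of \<open>\<gamma>\<^sub>0\<close>, and strict monotonicity in \<open>c\<close> forces
  \<open>c\<^sub>k(I) \<longlonglongrightarrow> c(I) = 1\<close>. Away from \<open>\<pi>\<close>, the density \<open>1 / \<gamma>\<^sub>k\<close> stays bounded, while
  \<open>\<gamma>\<^sub>k \<phi> \<le> d\<^sub>k + \<bar>\<phi> - \<pi>\<bar>\<close> with \<open>d\<^sub>k \<longlonglongrightarrow> 0\<close> makes its total mass diverge logarithmically. After
  normalisation all the mass therefore concentrates at \<open>\<pi>\<close>.
\<close>

section \<open>Elementary bounds for integrals and the cosine\<close>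

lemma integral_less_continuous:
  fixes g h :: "real \<Rightarrow> real"
  assumes "a < b" and g: "continuous_on {a..b} g" and h: "continuous_on {a..b} h"
    and le: "\<And>x. x \<in> {a..b} \<Longrightarrow> g x \<le> h x" and p: "p \<in> {a..b}" "g p < h p"
  shows "integral {a..b} g < integral {a..b} h"
proof -
  have int: "g integrable_on {a..b}" "h integrable_on {a..b}"
    using g h by (auto intro: integrable_continuous_real)
  \<comment> \<open>A continuous nonnegative function with zero integral vanishes everywhere, which
    the point \<open>p\<close> rules out.\<close>
  have "integral {a..b} (\<lambda>x. h x - g x) \<noteq> 0"
    using assms by (subst integral_eq_0_iff) (auto intro!: continuous_intros bexI[of _ p])
  moreover have "integral {a..b} g \<le> integral {a..b} h"
    using int le by (intro integral_le) auto
  ultimately show ?thesis using int by (simp add: integral_diff)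
qed

lemma continuous_on_interval_abs_bounded:
  fixes g :: "real \<Rightarrow> real"
  assumes "continuous_on {a..b} g"
  shows "\<exists>B. \<forall>x\<in>{a..b}. \<bar>g x\<bar> \<le> B"
proof -
  have "bounded (g ` {a..b})"
    using assms by (intro compact_imp_bounded compact_continuous_image) auto
  then show ?thesis by (auto simp: bounded_iff)
qed

text \<open>Half-angle formula with |sin t| \<le> |t|. The quadratic contact at the maximum of
  \<open>f\<close> is what makes \<open>\<gamma>\<^sub>k\<close> grow at most linearly away from
  \<pi>.\<close>

lemma cos_ge_quadratic: "1 - x\<^sup>2 / 2 \<le> cos (x :: real)"
proof -
  have "(sin (x / 2))\<^sup>2 \<le> (x / 2)\<^sup>2" by (intro abs_le_square_iff[THEN iffD1] abs_sin_x_le_abs_x)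
  then show ?thesis using cos_double_sin[of "x / 2"] by (simp add: power_divide)
qed

section \<open>The Lambert function and the implicit equation for
  \<open>\<gamma>\<^sub>k\<^sup>2\<close>\<close>

lemma Lambert_W_eq:
  assumes "z > 0"
  shows "Lambert_W z > 0" and "Lambert_W z * exp (Lambert_W z) = z"
proof -
  have strict: "w * exp w < w' * exp w'" if "0 \<le> w" "w < w'" for w w' :: real
    using that by (intro mult_strict_mono) auto
  \<comment> \<open>The endpoint \<open>z\<close> is large enough because \<open>exp z\<close> is at
    least 1. Together with \<open>strict\<close> this makes the description in
    \<open>Lambert_W\<close> well defined.\<close>
  have "\<exists>w. 0 \<le> w \<and> w \<le> z \<and> w * exp w = z"
  proof (rule IVT')
    show "z \<le> z * exp z" using assms by simp
  qed (use assms in \<open>auto intro!: continuous_intros\<close>)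
  then obtain w where w: "0 \<le> w" "w * exp w = z" by blast
  have "Lambert_W z = w"
    unfolding Lambert_W_def
  proof (rule the_equality)
    fix w' assume "0 \<le> w' \<and> z = w' * exp w'"
    then show "w' = w" using strict[of w w'] strict[of w' w] w by (cases w w' rule: linorder_cases) auto
  qed (use w in auto)
  moreover have "w \<noteq> 0" using w assms by auto
  ultimately show "Lambert_W z > 0" "Lambert_W z * exp (Lambert_W z) = z" using w by auto
qed

text \<open>The square \<open>\<gamma>\<^sub>k\<^sup>2\<close> as a function of \<open>s = 2 (c - f \<phi>)\<close>.\<close>

definition sq_gamma :: "nat \<Rightarrow> real \<Rightarrow> real" where
  "sq_gamma k s = Lambert_W (exp (s * real k) * real k) / real k"

lemma gamma_k_sq_gamma: "gamma_k f k c \<phi> = sqrt (sq_gamma k (2 * (c - f \<phi>)))"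
  by (simp add: gamma_k_def sq_gamma_def)

context
  fixes k :: nat
  assumes k: "k > 0"
begin

lemma sq_gamma_pos: "sq_gamma k s > 0"
  using k Lambert_W_eq(1)[of "exp (s * real k) * real k"] by (simp add: sq_gamma_def)

text \<open>Take logarithms in \<open>w * exp w = exp (s * k) * k\<close> and divide by
  \<open>k\<close>; substituting \<open>w = k * y\<close> absorbs the term
  \<open>ln k\<close>.\<close>

lemma sq_gamma_eq: "sq_gamma k s + ln (sq_gamma k s) / k = s"
proof -
  define w where "w = Lambert_W (exp (s * real k) * real k)"
  have w: "w > 0" "w * exp w = exp (s * real k) * real k"
    using Lambert_W_eq[of "exp (s * real k) * real k"] k by (auto simp: w_def)
  have "ln (w * exp w) = ln (exp (s * real k) * real k)" by (simp only: w)
  then have "w / k + (ln w - ln k) / k = s" using w(1) k by (simp add: ln_mult field_simps)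
  moreover have "sq_gamma k s = w / k" by (simp add: sq_gamma_def w_def)
  ultimately show ?thesis using w(1) k by (simp add: ln_div)
qed

text \<open>If \<open>y\<close> failed to increase, so would \<open>ln y / k\<close>, and hence
  their sum, which is \<open>s\<close>.\<close>

lemma sq_gamma_strict_mono:
  assumes "s < t"
  shows "sq_gamma k s < sq_gamma k t"
proof (rule ccontr)
  assume "\<not> sq_gamma k s < sq_gamma k t"
  then have le: "sq_gamma k t \<le> sq_gamma k s" by simp
  then have "ln (sq_gamma k t) / k \<le> ln (sq_gamma k s) / k"
    using sq_gamma_pos[of t] by (intro divide_right_mono) auto
  with le show False using sq_gamma_eq[of s] sq_gamma_eq[of t] assms by linarith
qed

text \<open>The increment of \<open>s\<close> is shared between \<open>y\<close> and
  \<open>ln y / k\<close>, and the share of the logarithm is nonnegative.\<close>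

lemma sq_gamma_diff_le:
  assumes "s \<le> t"
  shows "sq_gamma k t - sq_gamma k s \<le> t - s"
proof -
  have "sq_gamma k s \<le> sq_gamma k t"
    using sq_gamma_strict_mono[of s t] assms by (cases "s = t") auto
  then have "ln (sq_gamma k s) / k \<le> ln (sq_gamma k t) / k"
    using sq_gamma_pos[of s] by (intro divide_right_mono) auto
  then show ?thesis using sq_gamma_eq[of s] sq_gamma_eq[of t] by linarith
qed

lemma sq_gamma_lipschitz: "\<bar>sq_gamma k t - sq_gamma k s\<bar> \<le> \<bar>t - s\<bar>"
  using sq_gamma_diff_le[of s t] sq_gamma_diff_le[of t s]
    sq_gamma_strict_mono[of s t] sq_gamma_strict_mono[of t s]
  by (cases s t rule: linorder_cases) auto

lemma continuous_on_sq_gamma [continuous_intros]: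
  assumes "continuous_on A g"
  shows "continuous_on A (\<lambda>x. sq_gamma k (g x))"
proof -
  have "continuous_on UNIV (sq_gamma k)"
  proof (unfold continuous_on_iff, safe)
    fix s e :: real assume "e > 0"
    then show "\<exists>d>0. \<forall>t\<in>UNIV. dist t s < d \<longrightarrow> dist (sq_gamma k t) (sq_gamma k s) < e"
      using sq_gamma_lipschitz[of _ s] by (intro exI[of _ e]) (auto simp: dist_real_def intro: le_less_trans)
  qed
  then show ?thesis
    using continuous_on_compose2[OF _ assms] by blast
qed

text \<open>From \<open>ln y \<le> y\<close>. This lower bound on \<open>y\<close> later keeps
  \<open>1 / \<gamma>\<^sub>k\<close> bounded away from \<pi>.\<close>

lemma sq_gamma_ge: "s \<le> sq_gamma k s * (1 + 1 / k)"
proof -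
  have "ln (sq_gamma k s) \<le> sq_gamma k s"
    using ln_le_minus_one[OF sq_gamma_pos[of s]] by linarith
  then have "ln (sq_gamma k s) / k \<le> sq_gamma k s / k"
    by (intro divide_right_mono) auto
  then show ?thesis using sq_gamma_eq[of s] by (simp add: field_simps)
qed

text \<open>The threshold \<open>1 / k\<close> separates two regimes: below it \<open>y\<close> is
  itself within the error term, and above it \<open>ln y\<close> is at least \<open>- ln k\<close>,
  so the logarithm shifts \<open>y\<close> above \<open>s\<close> by at most
  \<open>ln k / k\<close>.\<close>

lemma sq_gamma_le: "sq_gamma k s \<le> max s 0 + (ln k + 1) / k"
proof (cases "sq_gamma k s \<le> 1 / k")
  case True
  moreover have "0 \<le> ln k / k" using k by simp
  ultimately show ?thesis by (simp add: add_divide_distrib)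
next
  case False
  have "ln (1 / k) \<le> ln (sq_gamma k s)" using False k sq_gamma_pos[of s] by (intro ln_mono) auto
  then have "- ln k \<le> ln (sq_gamma k s)" using k by (simp add: ln_div)
  then have "- ln k / k \<le> ln (sq_gamma k s) / k" by (intro divide_right_mono) auto
  then have "sq_gamma k s \<le> s + ln k / k" using sq_gamma_eq[of s] by linarith
  moreover have "0 \<le> 1 / real k" by simp
  ultimately show ?thesis unfolding add_divide_distrib by linarith
qed

end

section \<open>Uniform comparison of \<open>\<gamma>\<^sub>k\<close> with
  \<open>\<gamma>\<^sub>0\<close>\<close>

lemma gamma_zero_sqrt_max: "gamma_zero f c \<phi> = sqrt (max (2 * (c - f \<phi>)) 0)"
  by (auto simp: gamma_zero_def max_def)

text \<open>Transfers an additive error between squares to their roots, uniformly down to zero,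
  where the square root is not Lipschitz.\<close>

lemma sqrt_diff_le:
  assumes "0 \<le> x" "0 \<le> y" "x \<le> y + e" "0 \<le> e"
  shows "sqrt x \<le> sqrt y + sqrt e"
  by (rule order_trans[OF _ sqrt_add_le_add_sqrt]) (use assms in auto)

lemma gamma_k_minus_gamma_zero_le:
  assumes k: "k > 0" and s: "2 * (c - f \<phi>) \<le> M" "0 \<le> M"
  shows "\<bar>gamma_k f k c \<phi> - gamma_zero f c \<phi>\<bar> \<le> sqrt ((ln k + 1 + M) / k)"
proof -
  define s where "s = 2 * (c - f \<phi>)"
  let ?y = "sq_gamma k s"
  have pos: "?y > 0" by (rule sq_gamma_pos[OF k])
  have e: "0 \<le> (ln k + 1 + M) / k" using k s by simp
  have "(ln k + 1) / k \<le> (ln k + 1 + M) / k" using s(2) by (intro divide_right_mono) auto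
  then have "?y \<le> max s 0 + (ln k + 1 + M) / k"
    using sq_gamma_le[OF k, of s] by linarith
  then have 1: "sqrt ?y \<le> sqrt (max s 0) + sqrt ((ln k + 1 + M) / k)"
    using pos e by (intro sqrt_diff_le) auto
  have "max s 0 \<le> ?y + (ln k + 1 + M) / k"
  \<comment> \<open>\<open>sq_gamma_ge\<close> has the error \<open>y / k\<close>, which is at most
    \<open>M / k\<close> when \<open>y \<le> M\<close>. Otherwise \<open>y\<close> already exceeds
    both \<open>s\<close> and 0.\<close>
  proof (cases "?y \<le> M")
    case True
    have "?y / k \<le> (ln k + 1 + M) / k" using True k by (intro divide_right_mono) (auto simp: add_increasing)
    then show ?thesis using sq_gamma_ge[OF k, of s] pos e by (simp add: algebra_simps)
  next
    case False
    then show ?thesis using s e pos by (simp add: s_def)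
  qed
  then have 2: "sqrt (max s 0) \<le> sqrt ?y + sqrt ((ln k + 1 + M) / k)"
    using pos e by (intro sqrt_diff_le) auto
  show ?thesis using 1 2 by (simp add: gamma_k_sq_gamma gamma_zero_sqrt_max s_def)
qed

lemma tendsto_ln_div_nat: "(\<lambda>k. (ln (real k) + b) / real k) \<longlonglongrightarrow> 0"
  by real_asymp

section \<open>The averages as functions of \<open>c\<close>, and their limit\<close>

lemma continuous_on_integral_gamma_k:
  assumes k: "k > 0" and f: "continuous_on {0..2 * pi} f"
  shows "continuous_on A (\<lambda>c. integral {0..2 * pi} (gamma_k f k c))"
proof -
  have "continuous_on (A \<times> cbox 0 (2 * pi)) (\<lambda>(c, \<phi>). gamma_k f k c \<phi>)"
    unfolding gamma_k_sq_gamma case_prod_unfold using k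
    by (auto intro!: continuous_intros continuous_on_compose2[OF f])
  then show ?thesis using integral_continuous_on_param by fastforce
qed

lemma continuous_on_gamma_k:
  assumes "k > 0" and "continuous_on A f"
  shows "continuous_on A (gamma_k f k c)"
  using assms unfolding gamma_k_sq_gamma[abs_def] by (auto intro!: continuous_intros)

lemma continuous_on_integral_gamma_zero:
  assumes f: "continuous_on {0..2 * pi} f"
  shows "continuous_on A (\<lambda>c. integral {0..2 * pi} (gamma_zero f c))"
proof -
  have "continuous_on (A \<times> cbox 0 (2 * pi)) (\<lambda>(c, \<phi>). gamma_zero f c \<phi>)"
    unfolding gamma_zero_sqrt_max case_prod_unfold
    by (auto intro!: continuous_intros continuous_on_compose2[OF f])
  then show ?thesis using integral_continuous_on_param by fastforce
qed

lemma continuous_on_gamma_zero: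
  assumes "continuous_on A f"
  shows "continuous_on A (gamma_zero f c)"
  using assms unfolding gamma_zero_sqrt_max[abs_def] by (auto intro!: continuous_intros)

lemma integral_gamma_k_strict_mono:
  assumes k: "k > 0" and f: "continuous_on {0..2 * pi} f" and "c < d"
  shows "integral {0..2 * pi} (gamma_k f k c) < integral {0..2 * pi} (gamma_k f k d)"
proof -
  have "gamma_k f k c \<phi> < gamma_k f k d \<phi>" for \<phi>
    using assms by (simp add: gamma_k_sq_gamma sq_gamma_strict_mono)
  then show ?thesis
    using f k by (intro integral_less_continuous[where p = 0] continuous_on_gamma_k)
      (auto intro: less_imp_le)
qed

text \<open>For \<open>c\<close> below the minimum of \<open>f\<close> the integral is constantly
  zero, hence the positivity assumption. It supplies a point where \<open>gamma_zero f d\<close> is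
  nonzero, and there the integrand increases strictly.\<close>

lemma integral_gamma_zero_strict_mono:
  assumes f: "continuous_on {0..2 * pi} f" and "c < d"
    and pos: "integral {0..2 * pi} (gamma_zero f d) > 0"
  shows "integral {0..2 * pi} (gamma_zero f c) < integral {0..2 * pi} (gamma_zero f d)"
proof -
  have "\<exists>p\<in>{0..2 * pi}. gamma_zero f d p \<noteq> 0"
    using pos integral_cong[of "{0..2 * pi}" "gamma_zero f d" "\<lambda>_. 0"] by force
  then obtain p where p: "p \<in> {0..2 * pi}" "gamma_zero f d p \<noteq> 0" ..
  show ?thesis
  proof (rule integral_less_continuous)
    show "gamma_zero f c p < gamma_zero f d p"
      using p(2) \<open>c < d\<close> by (auto simp: gamma_zero_def split: if_splits)
    show "gamma_zero f c x \<le> gamma_zero f d x" for x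
      using \<open>c < d\<close> by (auto simp: gamma_zero_def)
  qed (use f p continuous_on_gamma_zero in auto)
qed

text \<open>On the compact interval \<open>2 * (c - f x)\<close> has an upper bound
  \<open>M\<close>, so the comparison with \<open>\<gamma>\<^sub>0\<close> is uniform and can be
  integrated.\<close>

lemma integral_gamma_k_tendsto:
  assumes f: "continuous_on {0..2 * pi} f"
  shows "(\<lambda>k. integral {0..2 * pi} (gamma_k f k c)) \<longlonglongrightarrow> integral {0..2 * pi} (gamma_zero f c)"
proof -
  obtain B where B: "\<And>x. x \<in> {0..2 * pi} \<Longrightarrow> \<bar>f x\<bar> \<le> B"
    using continuous_on_interval_abs_bounded[OF f] by blast
  define M where "M = max 0 (2 * (c + B))"
  define e where "e k = 2 * pi * sqrt ((ln (real k) + (1 + M)) / real k)" for k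
  have "e \<longlonglongrightarrow> 2 * pi * sqrt 0"
    unfolding e_def by (intro tendsto_intros tendsto_ln_div_nat)
  then have e0: "e \<longlonglongrightarrow> 0" by simp
  have "\<forall>\<^sub>F k in sequentially.
     norm (integral {0..2 * pi} (gamma_k f k c) - integral {0..2 * pi} (gamma_zero f c)) \<le> e k"
    using eventually_gt_at_top[of 0]
  proof eventually_elim
    case (elim k)
    note cont = continuous_on_gamma_k[OF elim f, of c] continuous_on_gamma_zero[OF f, of c]
    have "norm (integral {0..2 * pi} (\<lambda>x. gamma_k f k c x - gamma_zero f c x))
      \<le> sqrt ((ln (real k) + (1 + M)) / real k) * (2 * pi - 0)"
    proof (rule integral_bound)
      fix x assume "x \<in> {0..2 * pi}"
      then have "2 * (c - f x) \<le> M" using B[of x] by (auto simp: M_def)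
      then show "norm (gamma_k f k c x - gamma_zero f c x) \<le> sqrt ((ln (real k) + (1 + M)) / real k)"
        using gamma_k_minus_gamma_zero_le[OF elim, of c f x M] by (simp add: M_def add.assoc)
    qed (use cont in \<open>auto intro: continuous_on_diff\<close>)
    then show ?case
      using cont by (simp add: integral_diff integrable_continuous_real e_def mult.commute)
  qed
  then show ?thesis
    by (intro LIM_zero_cancel[OF Lim_null_comparison[OF _ e0]])
qed

section \<open>Well-definedness of \<open>c(I)\<close> and convergence of
  \<open>c\<^sub>k(I)\<close>\<close>

lemma c_zero_eq:
  assumes f: "continuous_on {0..2 * pi} f" and I: "I > 0"
  shows "integral {0..2 * pi} (gamma_zero f (c_zero f I)) = 2 * pi * I"
proof -
  let ?J = "\<lambda>c. integral {0..2 * pi} (gamma_zero f c)"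
  have iff: "I = 1 / (2 * pi) * x \<longleftrightarrow> x = 2 * pi * I" for x by (auto simp: field_simps)
  obtain B where B: "\<And>x. x \<in> {0..2 * pi} \<Longrightarrow> \<bar>f x\<bar> \<le> B"
    using continuous_on_interval_abs_bounded[OF f] by blast
  have B0: "B \<ge> 0" using B[of 0] by simp
  \<comment> \<open>At \<open>- B\<close> the integrand vanishes identically; at
    \<open>B + I\<^sup>2 / 2\<close> it is at least \<open>sqrt (I\<^sup>2) = I\<close>
    pointwise.\<close>
  have "\<exists>c. - B \<le> c \<and> c \<le> B + I\<^sup>2 / 2 \<and> ?J c = 2 * pi * I"
  proof (rule IVT')
    have "?J (- B) = integral {0..2 * pi} (\<lambda>_. 0)"
      using B by (intro integral_cong) (force simp: gamma_zero_def)
    then show "?J (- B) \<le> 2 * pi * I" using I by simp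
    have "integral {0..2 * pi} (\<lambda>_. I) \<le> ?J (B + I\<^sup>2 / 2)"
    proof (intro integral_le)
      fix x assume x: "x \<in> {0..2 * pi}"
      have "sqrt (I\<^sup>2) \<le> sqrt (max (2 * (B + I\<^sup>2 / 2 - f x)) 0)"
        using B[OF x] by (intro real_sqrt_le_mono) (auto simp: le_max_iff_disj)
      then show "I \<le> gamma_zero f (B + I\<^sup>2 / 2) x"
        using I by (simp add: gamma_zero_sqrt_max)
    qed (use f in \<open>auto intro!: integrable_continuous_real continuous_on_gamma_zero\<close>)
    then show "2 * pi * I \<le> ?J (B + I\<^sup>2 / 2)" by simp
    show "- B \<le> B + I\<^sup>2 / 2" using B0 zero_le_power2[of I] by linarith
  qed (rule continuous_on_integral_gamma_zero[OF f])
  then obtain c where c: "?J c = 2 * pi * I" by blast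
  have "d = c" if "?J d = 2 * pi * I" for d
    using c that I integral_gamma_zero_strict_mono[OF f, of c d] integral_gamma_zero_strict_mono[OF f, of d c]
    by (cases c d rule: linorder_cases) auto
  with c have "c_zero f I = c" unfolding c_zero_def iff by (intro the_equality)
  with c show ?thesis by simp
qed

text \<open>The limiting average lies strictly on either side of the target at
  \<open>c(I) - e\<close> and \<open>c(I) + e\<close>. For large \<open>k\<close> the same holds for
  the average of \<open>\<gamma>\<^sub>k\<close>, so its unique solution is trapped in
  between.\<close>

lemma c_k_tendsto:
  assumes f: "continuous_on {0..2 * pi} f" and I: "I > 0"
  shows "(\<lambda>k. c_k f k I) \<longlonglongrightarrow> c_zero f I"
proof (rule LIMSEQ_I)
  fix r :: real assume "r > 0"
  \<comment> \<open>The intermediate value theorem places the root in a closed interval, so a radius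
    smaller than \<open>r\<close> gives the strict bound.\<close>
  define e where "e = r / 2"
  have e: "e > 0" "e < r" using \<open>r > 0\<close> by (auto simp: e_def)
  let ?J = "\<lambda>k c. integral {0..2 * pi} (gamma_k f k c)"
  let ?L = "\<lambda>c. integral {0..2 * pi} (gamma_zero f c)"
  let ?c = "c_zero f I"
  have iff: "I = 1 / (2 * pi) * x \<longleftrightarrow> x = 2 * pi * I" for x by (auto simp: field_simps)
  have J0: "?L ?c = 2 * pi * I" by (rule c_zero_eq[OF f I])
  then have less1: "?L (?c - e) < 2 * pi * I"
    using integral_gamma_zero_strict_mono[OF f, of "?c - e" ?c] e I by auto
  have "?L ?c < ?L (?c + e)"
  proof (intro integral_gamma_zero_strict_mono[OF f])
    have "?L ?c \<le> ?L (?c + e)"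
      using f e by (intro integral_le) (auto intro!: integrable_continuous_real continuous_on_gamma_zero simp: gamma_zero_def)
    moreover have "?L ?c > 0" using J0 I by simp
    ultimately show "0 < ?L (?c + e)" by linarith
  qed (use e in auto)
  with J0 have less2: "2 * pi * I < ?L (?c + e)" by simp
  have "\<forall>\<^sub>F k in sequentially. norm (c_k f k I - ?c) < r"
    using eventually_gt_at_top[of 0]
      order_tendstoD(2)[OF integral_gamma_k_tendsto[OF f] less1]
      order_tendstoD(1)[OF integral_gamma_k_tendsto[OF f] less2]
  proof eventually_elim
    case (elim k)
    have "\<exists>c. ?c - e \<le> c \<and> c \<le> ?c + e \<and> ?J k c = 2 * pi * I"
      using elim e continuous_on_integral_gamma_k[OF elim(1) f] by (intro IVT') auto
    then obtain c where c: "?c - e \<le> c" "c \<le> ?c + e" "?J k c = 2 * pi * I" by blast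
    have "d = c" if "?J k d = 2 * pi * I" for d
      using c that integral_gamma_k_strict_mono[OF elim(1) f, of c d]
        integral_gamma_k_strict_mono[OF elim(1) f, of d c]
      by (cases c d rule: linorder_cases) auto
    with c have "c_k f k I = c" unfolding c_k_def iff by (intro the_equality)
    with c e show ?case by auto
  qed
  then show "\<exists>no. \<forall>n\<ge>no. norm (c_k f n I - ?c) < r" by (simp add: eventually_sequentially)
qed

section \<open>Concentration of normalised densities whose mass diverges only at one point\<close>

lemma concentration_tendsto:
  fixes g :: "nat \<Rightarrow> real \<Rightarrow> real" and u :: "real \<Rightarrow> real"
  assumes "a \<le> b" and p: "p \<in> {a..b}" and u: "continuous_on {a..b} u"
    and g: "\<forall>\<^sub>F k in sequentially. continuous_on {a..b} (g k)"
    and pos: "\<forall>\<^sub>F k in sequentially. \<forall>x\<in>{a..b}. 0 \<le> g k x"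
    and mass: "filterlim (\<lambda>k. integral {a..b} (g k)) at_top sequentially"
    and away: "\<And>d. d > 0 \<Longrightarrow> \<exists>C. \<forall>\<^sub>F k in sequentially. \<forall>x\<in>{a..b}. d \<le> \<bar>x - p\<bar> \<longrightarrow> g k x \<le> C"
  shows "(\<lambda>k. integral {a..b} (\<lambda>x. u x * (g k x / integral {a..b} (g k)))) \<longlonglongrightarrow> u p"
proof (rule LIMSEQ_I)
  fix r :: real assume "r > 0"
  define e where "e = r / 2"
  have e: "e > 0" using \<open>r > 0\<close> by (simp add: e_def)
  have "continuous_on {a..b} (\<lambda>x. u x - u p)" using u by (intro continuous_intros)
  from continuous_on_interval_abs_bounded[OF this]
  obtain B where B: "\<And>x. x \<in> {a..b} \<Longrightarrow> \<bar>u x - u p\<bar> \<le> B" by blast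
  have B0: "B \<ge> 0" using B[OF p] by simp
  obtain d where d: "d > 0" "\<And>x. x \<in> {a..b} \<Longrightarrow> \<bar>x - p\<bar> < d \<Longrightarrow> \<bar>u x - u p\<bar> < e"
    using u[unfolded continuous_on_iff, rule_format, OF p e] by (auto simp: dist_real_def)
  obtain C' where C': "\<forall>\<^sub>F k in sequentially. \<forall>x\<in>{a..b}. d \<le> \<bar>x - p\<bar> \<longrightarrow> g k x \<le> C'"
    using away[OF d(1)] by blast
  \<comment> \<open>The maximum with 0 makes \<open>B * C\<close> nonnegative; \<open>K\<close> then
    bounds the contribution from distance at least \<open>d\<close>, independently of
    \<open>k\<close>.\<close>
  define C where "C = max 0 C'"
  define K where "K = B * C * (b - a)"
  have K: "K \<ge> 0" using B0 \<open>a \<le> b\<close> by (simp add: K_def C_def)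
  \<comment> \<open>Once the mass \<open>G\<close> exceeds \<open>K / e\<close>, the near part
    \<open>e * G\<close> and the far part \<open>K\<close> add up to less than
    \<open>2 * e * G = r * G\<close>.\<close>
  have "\<forall>\<^sub>F k in sequentially.
      norm (integral {a..b} (\<lambda>x. u x * (g k x / integral {a..b} (g k))) - u p) < r"
    using g pos C' mass[unfolded filterlim_at_top_dense, rule_format, of "K / e"]
  proof eventually_elim
    case (elim k)
    define G where "G = integral {a..b} (g k)"
    have "0 \<le> K / e" using K e by simp
    moreover have "K / e < G" using elim(4) by (simp add: G_def)
    ultimately have G: "G > 0" "K < e * G" using e by (linarith, simp add: pos_divide_less_eq mult.commute)
    have ints: "g k integrable_on {a..b}" "(\<lambda>x. u x * g k x) integrable_on {a..b}"
      "(\<lambda>x. u p * g k x) integrable_on {a..b}" "(\<lambda>x. (u x - u p) * g k x) integrable_on {a..b}"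
      "(\<lambda>x. e * g k x + B * C) integrable_on {a..b}"
      using u elim(1) by (auto intro!: integrable_continuous_real continuous_intros)
    \<comment> \<open>The first summand dominates near \<open>p\<close>, the second away from it.
      Both are nonnegative, so their sum is a bound everywhere and the interval need not be
      split.\<close>
    have "norm (integral {a..b} (\<lambda>x. (u x - u p) * g k x)) \<le> integral {a..b} (\<lambda>x. e * g k x + B * C)"
    proof (rule integral_norm_bound_integral)
      fix x assume x: "x \<in> {a..b}"
      have gx: "g k x \<ge> 0" using elim(2) x by blast
      have "\<bar>u x - u p\<bar> * g k x \<le> e * g k x + B * C"
      proof (cases "\<bar>x - p\<bar> < d")
        case True
        then have "\<bar>u x - u p\<bar> * g k x \<le> e * g k x"
          using d(2)[OF x] gx by (intro mult_right_mono) auto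
        then show ?thesis using B0 by (simp add: C_def add_increasing2)
      next
        case False
        then have "g k x \<le> C" using elim(3) x by (auto simp: C_def le_max_iff_disj)
        then have "\<bar>u x - u p\<bar> * g k x \<le> B * C"
          using B[OF x] B0 gx by (intro mult_mono) auto
        then show ?thesis using e gx by (simp add: add_increasing)
      qed
      then show "norm ((u x - u p) * g k x) \<le> e * g k x + B * C" using gx by (simp add: abs_mult)
    qed (use ints in blast)+
    also have "\<dots> = e * G + K"
    proof (rule integral_unique)
      have "((\<lambda>x. e * g k x) has_integral e * G) {a..b}"
        unfolding G_def using ints(1) by (intro has_integral_mult_right integrable_integral)
      moreover have "((\<lambda>x. B * C) has_integral K) {a..b}"
        using has_integral_const_real[of "B * C" a b] \<open>a \<le> b\<close> by (simp add: K_def mult.commute)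
      ultimately show "((\<lambda>x. e * g k x + B * C) has_integral e * G + K) {a..b}"
        by (rule has_integral_add)
    qed
    also have "\<dots> < r * G" using G by (simp add: e_def)
    finally have "\<bar>integral {a..b} (\<lambda>x. (u x - u p) * g k x)\<bar> < r * G" by simp
    moreover have "integral {a..b} (\<lambda>x. (u x - u p) * g k x) = integral {a..b} (\<lambda>x. u x * g k x) - u p * G"
      unfolding left_diff_distrib integral_diff[OF ints(2,3)] integral_mult_right G_def ..
    ultimately have "\<bar>integral {a..b} (\<lambda>x. u x * g k x) - u p * G\<bar> / G < r"
      using G by (simp add: pos_divide_less_eq)
    moreover have "\<bar>integral {a..b} (\<lambda>x. u x * g k x) - u p * G\<bar> / G
      = \<bar>integral {a..b} (\<lambda>x. u x * g k x) / G - u p\<bar>"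
      using G by (simp add: diff_divide_distrib abs_div_pos)
    moreover have "integral {a..b} (\<lambda>x. u x * (g k x / G)) = integral {a..b} (\<lambda>x. u x * g k x) / G"
      unfolding times_divide_eq_right integral_divide ..
    ultimately show ?case unfolding G_def by simp
  qed
  then show "\<exists>no. \<forall>n\<ge>no. norm (integral {a..b} (\<lambda>x. u x * (g n x / integral {a..b} (g n))) - u p) < r"
    by (simp add: eventually_sequentially)
qed

section \<open>Logarithmic divergence of the mass at \<pi>, and the limit for
  \<open>f = - cos\<close>\<close>

lemma integral_inverse_shift:
  fixes d :: real
  assumes "d > 0" "a \<le> b"
  shows "((\<lambda>x. 1 / (d + (x - a))) has_integral ln (d + (b - a)) - ln d) {a..b}"
proof -
  have "((\<lambda>x. 1 / (d + (x - a))) has_integral ln (d + (b - a)) - ln (d + (a - a))) {a..b}"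
    using assms
    by (intro fundamental_theorem_of_calculus)
      (auto intro!: derivative_eq_intros simp flip: has_real_derivative_iff_has_vector_derivative)
  then show ?thesis by simp
qed

theorem proposition3p3:
  fixes f u :: "real \<Rightarrow> real" and I :: real
  assumes f: "f = (\<lambda>\<phi>. - cos \<phi>)"
    and I_pos: "I > 0"
    and separatrix: "c_zero f I = f pi"
    and u: "smooth_on_circle u"
  shows "(\<lambda>k. integral {0..2 * pi} (\<lambda>\<phi>. u \<phi> * sigma_k f k I \<phi>)) \<longlonglongrightarrow> u pi"
proof -
  have cf: "continuous_on A f" for A unfolding f by (intro continuous_intros)
  define c where "c k = c_k f k I" for k
  have c: "c \<longlonglongrightarrow> 1"
    using c_k_tendsto[OF cf I_pos] by (simp add: c_def[abs_def] separatrix) (simp add: f)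
  define g where "g k \<phi> = 1 / gamma_k f k (c k) \<phi>" for k \<phi>
  have gamma_pos: "gamma_k f k (c k) \<phi> > 0" if "k > 0" for k \<phi>
    using sq_gamma_pos[OF that] by (simp add: gamma_k_sq_gamma)
  have cg: "continuous_on A (g k)" if "k > 0" for k A
    unfolding g_def using gamma_pos[OF that] continuous_on_gamma_k[OF that cf]
    by (intro continuous_intros) (auto simp: less_imp_neq[symmetric])
  have g_nonneg: "g k \<phi> \<ge> 0" if "k > 0" for k \<phi>
    using gamma_pos[OF that, of \<phi>] by (simp add: g_def)

  \<comment> \<open>The two sources of error at \<pi>: the displacement of \<open>c k\<close> from
    the critical value 1, and the error term of \<open>sq_gamma_le\<close>.\<close>
  define d where "d k = sqrt (2 * \<bar>c k - 1\<bar> + (ln (real k) + 1) / real k)" for k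
  have "d \<longlonglongrightarrow> sqrt (2 * \<bar>1 - 1\<bar> + 0)"
    unfolding d_def by (intro tendsto_intros c tendsto_ln_div_nat)
  then have d0: "d \<longlonglongrightarrow> 0" by simp
  have d_pos: "d k > 0" if "k > 0" for k
  proof -
    have "(ln (real k) + 1) / real k > 0" using that by (simp add: add_nonneg_pos)
    then show ?thesis unfolding d_def by (simp add: add_nonneg_pos)
  qed
  have gamma_le: "gamma_k f k (c k) \<phi> \<le> d k + \<bar>\<phi> - pi\<bar>" if "k > 0" for k \<phi>
  proof -
    define q where "q = (\<phi> - pi)\<^sup>2"
    have "1 - q / 2 \<le> - cos \<phi>" using cos_ge_quadratic[of "\<phi> - pi"] by (simp add: q_def cos_diff)
    moreover have "q \<ge> 0" by (simp add: q_def)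
    moreover define t where "t = \<bar>c k - 1\<bar>"
    then have "c k - 1 \<le> t" "t \<ge> 0" by auto
    ultimately have "max (2 * (c k + cos \<phi>)) 0 \<le> 2 * \<bar>c k - 1\<bar> + q"
      unfolding t_def[symmetric] by simp
    then have "sq_gamma k (2 * (c k + cos \<phi>)) \<le> q + (2 * \<bar>c k - 1\<bar> + (ln (real k) + 1) / real k)"
      using sq_gamma_le[OF that, of "2 * (c k + cos \<phi>)"] by linarith
    then have "sqrt (sq_gamma k (2 * (c k + cos \<phi>))) \<le> sqrt q + d k"
      unfolding d_def using that sq_gamma_pos[OF that]
      by (intro sqrt_diff_le) (auto simp: q_def intro: less_imp_le)
    then show ?thesis by (simp add: gamma_k_sq_gamma f q_def)
  qed
  \<comment> \<open>The right half of the interval suffices: there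
    \<open>g k x \<ge> 1 / (d k + (x - pi))\<close>, whose integral is at least
    \<open>ln pi - ln (d k)\<close>.\<close>
  have mass: "filterlim (\<lambda>k. integral {0..2 * pi} (g k)) at_top sequentially"
  proof (rule filterlim_at_top_mono)
    have "filterlim d (at_right 0) sequentially"
      unfolding filterlim_at using d0 d_pos
      by (auto intro: eventually_mono[OF eventually_gt_at_top[of 0]] simp: less_imp_neq[symmetric])
    then have "filterlim (\<lambda>k. ln (d k)) at_bot sequentially"
      by (rule filterlim_compose[OF ln_at_0])
    then have "filterlim (\<lambda>k. - ln (d k)) at_top sequentially"
      by (simp add: filterlim_uminus_at_bot)
    then show "filterlim (\<lambda>k. ln pi + - ln (d k)) at_top sequentially"
      by (intro filterlim_tendsto_add_at_top[OF tendsto_const])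
    show "\<forall>\<^sub>F k in sequentially. ln pi + - ln (d k) \<le> integral {0..2 * pi} (g k)"
      using eventually_gt_at_top[of 0]
    proof eventually_elim
      case (elim k)
      note int = integral_inverse_shift[OF d_pos[OF elim], of pi "2 * pi"]
      have "ln pi + - ln (d k) \<le> ln (d k + (2 * pi - pi)) - ln (d k)"
        using d_pos[OF elim] ln_mono[of pi "d k + pi"] by simp
      also have "\<dots> \<le> integral {pi..2 * pi} (g k)"
      proof (rule has_integral_le[OF int])
        show "(g k has_integral integral {pi..2 * pi} (g k)) {pi..2 * pi}"
          using cg[OF elim] by (intro integrable_integral integrable_continuous_real)
        fix x assume "x \<in> {pi..2 * pi}"
        then show "1 / (d k + (x - pi)) \<le> g k x"
          unfolding g_def using gamma_le[OF elim, of x] gamma_pos[OF elim, of x]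
          by (intro divide_left_mono) auto
      qed simp
      also have "\<dots> \<le> integral {0..2 * pi} (g k)"
        using cg[OF elim] g_nonneg[OF elim]
        by (intro integral_subset_le) (auto intro!: integrable_continuous_real)
      finally show ?case .
    qed
  qed

  have away: "\<exists>C. \<forall>\<^sub>F k in sequentially. \<forall>x\<in>{0..2 * pi}. e \<le> \<bar>x - pi\<bar> \<longrightarrow> g k x \<le> C" if "e > 0" for e
  proof -
    \<comment> \<open>Capping at \<pi> keeps \<open>e'\<close> where the cosine is decreasing in the
      distance to \<pi>. Then \<open>m\<close> is a positive lower bound for
      \<open>1 + cos x\<close> at distance at least \<open>e\<close> from \<pi>.\<close>
    define e' where "e' = min e pi"
    define m where "m = 1 - cos e'"
    have e': "0 < e'" "e' \<le> pi" using that by (auto simp: e'_def)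
    have m: "m > 0" using cos_monotone_0_pi[of 0 e'] e' by (simp add: m_def)
    \<comment> \<open>Half of \<open>m\<close> is given up to the convergence of \<open>c k\<close>,
      leaving \<open>2 * (c k + cos x) \<ge> m\<close>. The factor \<open>1 + 1 / k \<le> 2\<close>
      then costs the other half in \<open>y \<ge> m / 2\<close>.\<close>
    have "\<forall>\<^sub>F k in sequentially. 1 - m / 2 < c k" using m by (intro order_tendstoD(1)[OF c]) auto
    then have "\<forall>\<^sub>F k in sequentially. \<forall>x\<in>{0..2 * pi}. e \<le> \<bar>x - pi\<bar> \<longrightarrow> g k x \<le> 1 / sqrt (m / 2)"
      using eventually_gt_at_top[of 0]
    proof eventually_elim
      case (elim k)
      show ?case
      proof (intro ballI impI)
        fix x assume x: "x \<in> {0..2 * pi}" "e \<le> \<bar>x - pi\<bar>"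
        have "cos \<bar>x - pi\<bar> \<le> cos e'"
          using x e' by (intro cos_monotone_0_pi_le) (auto simp: e'_def)
        then have "m \<le> 1 + cos x" by (simp add: m_def cos_diff)
        then have "m \<le> 2 * (c k + cos x)" using elim(1) by simp
        also have "\<dots> \<le> sq_gamma k (2 * (c k + cos x)) * (1 + 1 / real k)"
          by (rule sq_gamma_ge[OF elim(2)])
        also have "\<dots> \<le> sq_gamma k (2 * (c k + cos x)) * 2"
          using elim(2) sq_gamma_pos[OF elim(2)] by (intro mult_left_mono) (auto intro: less_imp_le)
        finally have "sqrt (m / 2) \<le> gamma_k f k (c k) x"
          by (simp add: gamma_k_sq_gamma f)
        then show "g k x \<le> 1 / sqrt (m / 2)"
          unfolding g_def using m gamma_pos[OF elim(2), of x] by (intro divide_left_mono) auto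
      qed
    qed
    then show ?thesis by blast
  qed

  \<comment> \<open>This is the case \<open>n = 0\<close> of the smoothness condition.\<close>
  have "u differentiable (at \<phi>)" for \<phi>
    using u unfolding smooth_on_circle_def by (metis funpow_0)
  then have cu: "continuous_on {0..2 * pi} u"
    by (intro differentiable_imp_continuous_on) (simp add: differentiable_on_def differentiable_at_withinI)
  have "(\<lambda>k. integral {0..2 * pi} (\<lambda>x. u x * (g k x / integral {0..2 * pi} (g k)))) \<longlonglongrightarrow> u pi"
    using cu mass away cg g_nonneg
    by (intro concentration_tendsto) (auto intro: eventually_mono[OF eventually_gt_at_top[of 0]])
  then show ?thesis unfolding sigma_k_def g_def[abs_def] c_def .
qed

end
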